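(* Let $\omega=\frac{-1+\sqrt{-3}}{2}$, $\mathcal{O}_K=\mathbb{Z}+\mathbb{Z}\omega$, and for $\alpha,\beta\in\mathbb{C}$ let $[\alpha,\beta]=\begin{pmatrix}1&\alpha&\beta\\0&1&\bar\alpha\\0&0&1\end{pmatrix}$. Let $N(\mathcal{O}_K)=\{[\alpha,\beta]:\alpha,\beta\in\mathcal{O}_K,\ \beta+\bar\beta=\alpha\bar\alpha\}$. Then $N(\mathcal{O}_K)$ is the group generated by $$T_1=\begin{pmatrix}1&1&-\omega\\0&1&1\\0&0&1\end{pmatrix},\qquad T_2=\begin{pmatrix}1&\omega&-\omega\\0&1&\bar\omega\\0&0&1\end{pmatrix}.$$
   Context: $N(\mathcal{O}_K)$ is a group under matrix multiplication (it is the intersection of the unipotent radical of the upper triangular parabolic subgroup of $U(2,1)=\{g\in GL(3,\mathbb{C}):g^*Jg=J\}$, $J=\begin{pmatrix}0&0&1\\0&-1&0\\1&0&0\end{pmatrix}$, with $U(2,1;\mathcal{O}_K)$). *)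

theory Defs
  imports "HOL-Analysis.Analysis" "HOL-Algebra.Generated_Groups"
begin

definition \<omega> :: complex
  where "\<omega> = (-1 + \<i> * complex_of_real (sqrt 3)) / 2"

definition O_K :: "complex set"
  where "O_K = {of_int m + of_int n * \<omega> | m n. True}"

definition heis :: "complex \<Rightarrow> complex \<Rightarrow> complex^3^3"
  where "heis \<alpha> \<beta> = vector [vector [1, \<alpha>, \<beta>], vector [0, 1, cnj \<alpha>], vector [0, 0, 1]]"

definition N_O_K :: "(complex^3^3) set"
  where "N_O_K = {heis \<alpha> \<beta> | \<alpha> \<beta>. \<alpha> \<in> O_K \<and> \<beta> \<in> O_K \<and> \<beta> + cnj \<beta> = \<alpha> * cnj \<alpha>}"

definition T1 :: "complex^3^3"
  where "T1 = vector [vector [1, 1, - \<omega>], vector [0, 1, 1], vector [0, 0, 1]]"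

definition T2 :: "complex^3^3"
  where "T2 = vector [vector [1, \<omega>, - \<omega>], vector [0, 1, cnj \<omega>], vector [0, 0, 1]]"

definition GL3 :: "(complex^3^3) monoid"
  where "GL3 = \<lparr>carrier = {A. invertible A}, mult = (\<lambda>A B. A ** B), one = mat 1\<rparr>"

lemma group_GL3: "group GL3"
proof (rule groupI)
  fix A assume "A \<in> carrier GL3"
  then obtain B where "A ** B = mat 1" "B ** A = mat 1"
    by (auto simp: GL3_def invertible_def)
  then show "\<exists>B\<in>carrier GL3. B \<otimes>\<^bsub>GL3\<^esub> A = \<one>\<^bsub>GL3\<^esub>"
    by (auto simp: GL3_def invertible_def)
qed (auto simp: GL3_def invertible_mult matrix_mul_assoc invertible_def[of "mat 1"])

lemma heis_in_GL3: "heis \<alpha> \<beta> \<in> carrier GL3"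
  by (simp add: GL3_def heis_def invertible_det_nz det_3 vector_3)

lemma T1_eq_heis: "T1 = heis 1 (- \<omega>)"
  by (simp add: T1_def heis_def)

lemma T2_eq_heis: "T2 = heis \<omega> (- \<omega>)"
  by (simp add: T2_def heis_def)

end

theory Submission
  imports Defs
begin

text \<open>The map \<open>[\<alpha>, \<beta>] \<mapsto> \<alpha>\<close> is a homomorphism from \<open>N(O\<^sub>K)\<close> onto \<open>O\<^sub>K\<close> whose kernel consists of the central
  elements \<open>[0, k \<surd>-3]\<close> with \<open>k\<close> an integer. The images \<open>1\<close> and \<open>\<omega>\<close> of \<open>T\<^sub>1\<close> and \<open>T\<^sub>2\<close> generate \<open>O\<^sub>K\<close>, and the
  commutator of \<open>T\<^sub>2\<close> and \<open>T\<^sub>1\<close> is \<open>[0, \<omega> - cnj \<omega>] = [0, \<surd>-3]\<close>, which generates the kernel.\<close>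

interpretation GL3: group GL3
  by (rule group_GL3)

lemma cnj_omega: "cnj \<omega> = -1 - \<omega>"
  by (simp add: \<omega>_def complex_eq_iff)

lemma omega_square: "\<omega> * \<omega> = -1 - \<omega>"
  by (simp add: \<omega>_def complex_eq_iff)

lemma O_K_intros:
  assumes "x \<in> O_K" "y \<in> O_K"
  shows O_K_add: "x + y \<in> O_K"
    and O_K_uminus: "- x \<in> O_K"
    and O_K_mult: "x * y \<in> O_K"
    and O_K_cnj: "cnj x \<in> O_K"
proof -
  from assms obtain m n p q where xy: "x = of_int m + of_int n * \<omega>" "y = of_int p + of_int q * \<omega>"
    by (auto simp: O_K_def)
  have "x + y = of_int (m + p) + of_int (n + q) * \<omega>" "- x = of_int (- m) + of_int (- n) * \<omega>"
    "cnj x = of_int (m - n) + of_int (- n) * \<omega>"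
    by (simp_all add: xy cnj_omega algebra_simps)
  moreover have "x * y = of_int (m * p) + of_int (m * q + n * p) * \<omega> + of_int (n * q) * (\<omega> * \<omega>)"
    by (simp add: xy algebra_simps)
  then have "x * y = of_int (m * p - n * q) + of_int (m * q + n * p - n * q) * \<omega>"
    by (simp add: omega_square algebra_simps)
  ultimately show "x + y \<in> O_K" "- x \<in> O_K" "x * y \<in> O_K" "cnj x \<in> O_K"
    unfolding O_K_def by blast+
qed

text \<open>Twice the real part of \<open>m + n * \<omega>\<close> is \<open>2 * m - n\<close>. If
  it vanishes, the element is \<open>m * (1 + 2 * \<omega>)\<close>, and
  \<open>1 + 2 * \<omega>\<close> is \<open>\<omega> - cnj \<omega>\<close>.\<close>

lemma O_K_imaginary:
  assumes "z \<in> O_K" "z + cnj z = 0"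
  obtains k where "z = of_int k * (\<omega> - cnj \<omega>)"
proof -
  from assms(1) obtain m n where z: "z = of_int m + of_int n * \<omega>"
    by (auto simp: O_K_def)
  have "of_int (2 * m - n) = (0 :: complex)"
    using assms(2) by (simp add: z cnj_omega algebra_simps)
  then have "n = 2 * m"
    by (simp only: of_int_eq_0_iff)
  then have "z = of_int m * (\<omega> - cnj \<omega>)"
    by (simp add: z cnj_omega algebra_simps)
  then show thesis by (rule that)
qed

lemma heis_mult: "heis a b \<otimes>\<^bsub>GL3\<^esub> heis c d = heis (a + c) (b + d + a * cnj c)"
  by (simp add: GL3_def heis_def matrix_matrix_mult_def vec_eq_iff forall_3 sum_3 vector_3)

lemma heis_one: "\<one>\<^bsub>GL3\<^esub> = heis 0 0"
  by (simp add: GL3_def heis_def mat_def vec_eq_iff forall_3 vector_3)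

text \<open>The entry \<open>a * cnj a - b\<close> is valid for arbitrary \<open>a\<close> and
  \<open>b\<close>; on \<open>N_O_K\<close> it equals \<open>cnj b\<close>.\<close>

lemma heis_inv: "inv\<^bsub>GL3\<^esub> heis a b = heis (- a) (a * cnj a - b)"
  by (rule GL3.inv_equality) (simp_all add: heis_mult heis_one heis_in_GL3)

lemma heis_inject: "heis a b = heis c d \<longleftrightarrow> a = c \<and> b = d"
  by (auto simp: heis_def vec_eq_iff forall_3 vector_3)

lemma heis_in_N_O_K:
  "heis a b \<in> N_O_K \<longleftrightarrow> a \<in> O_K \<and> b \<in> O_K \<and> b + cnj b = a * cnj a"
  by (auto simp: N_O_K_def heis_inject)

lemma zero_in_O_K: "0 \<in> O_K"
  unfolding O_K_def by (rule CollectI, intro exI[of _ 0]) simp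

lemma one_in_O_K: "1 \<in> O_K"
  unfolding O_K_def by (rule CollectI, intro exI[of _ 1] exI[of _ 0]) simp

lemma omega_in_O_K: "\<omega> \<in> O_K"
  unfolding O_K_def by (rule CollectI, intro exI[of _ 0] exI[of _ 1]) simp

lemma subgroup_N_O_K: "subgroup N_O_K GL3"
proof
  show "N_O_K \<subseteq> carrier GL3"
    by (auto simp: N_O_K_def heis_in_GL3)
  show "\<one>\<^bsub>GL3\<^esub> \<in> N_O_K"
    by (simp add: heis_one heis_in_N_O_K zero_in_O_K)
next
  fix x assume "x \<in> N_O_K"
  then obtain a b where x: "x = heis a b" and N: "a \<in> O_K" "b \<in> O_K" "b + cnj b = a * cnj a"
    by (auto simp: N_O_K_def)
  have "a * cnj a + - b \<in> O_K"
    using N by (intro O_K_intros)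
  moreover have "a * cnj a - b + cnj (a * cnj a - b) = a * cnj a"
    using N(3) by (simp add: algebra_simps)
  ultimately show "inv\<^bsub>GL3\<^esub> x \<in> N_O_K"
    using N by (simp add: x heis_inv heis_in_N_O_K O_K_uminus)
next
  fix x y assume "x \<in> N_O_K" "y \<in> N_O_K"
  then obtain a b c d where xy: "x = heis a b" "y = heis c d"
    and N: "a \<in> O_K" "b \<in> O_K" "b + cnj b = a * cnj a"
           "c \<in> O_K" "d \<in> O_K" "d + cnj d = c * cnj c"
    by (auto simp: N_O_K_def)
  have "b + d + a * cnj c \<in> O_K"
    using N by (intro O_K_intros)
  \<comment> \<open>Grouping each entry with its conjugate lets both norm conditions be substituted;
    the two cross terms then complete the norm of \<open>a + c\<close>.\<close>
  moreover have "b + d + a * cnj c + cnj (b + d + a * cnj c)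
      = (b + cnj b) + (d + cnj d) + a * cnj c + cnj a * c"
    by (simp add: algebra_simps)
  then have "b + d + a * cnj c + cnj (b + d + a * cnj c) = (a + c) * cnj (a + c)"
    unfolding N(3,6) by (simp add: algebra_simps)
  ultimately show "x \<otimes>\<^bsub>GL3\<^esub> y \<in> N_O_K"
    using N by (simp add: xy heis_mult heis_in_N_O_K O_K_add)
qed

text \<open>Used twice below: for the first coordinates occurring in the generated group and for its
  central part.\<close>

lemma of_int_mult_mem:
  fixes x :: "'a :: ring_1"
  assumes "x \<in> S" and "0 \<in> S"
    and add: "\<And>x y. x \<in> S \<Longrightarrow> y \<in> S \<Longrightarrow> x + y \<in> S" and uminus: "\<And>x. x \<in> S \<Longrightarrow> - x \<in> S"
  shows "of_int k * x \<in> S"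
proof (induction k rule: int_induct[where k = 0])
  case base
  then show ?case using assms(2) by simp
next
  case (step1 i)
  then show ?case using add[OF step1(2) assms(1)] by (simp add: algebra_simps)
next
  case (step2 i)
  then show ?case using add[OF step2(2) uminus[OF assms(1)]] by (simp add: algebra_simps)
qed

theorem theorem3p1:
  shows "N_O_K = generate GL3 {T1, T2}"
proof
  \<comment> \<open>Both norm conditions hold because \<open>- \<omega> - cnj \<omega>\<close> is 1,
    and 1 and \<open>\<omega>\<close> have norm 1.\<close>
  have T_in: "{T1, T2} \<subseteq> N_O_K"
    using zero_in_O_K one_in_O_K omega_in_O_K
    by (auto simp: T1_eq_heis T2_eq_heis heis_in_N_O_K O_K_uminus cnj_omega omega_square algebra_simps)
  then show gen_sub: "generate GL3 {T1, T2} \<subseteq> N_O_K"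
    by (rule GL3.generate_subgroup_incl[OF _ subgroup_N_O_K])
  define H where "H = generate GL3 {T1, T2}"
  interpret H: subgroup H GL3
    unfolding H_def by (rule GL3.generate_is_subgroup) (auto simp: T1_eq_heis T2_eq_heis heis_in_GL3)
  have mult: "heis (a + c) (b + d + a * cnj c) \<in> H" if "heis a b \<in> H" "heis c d \<in> H" for a b c d
    using H.m_closed[OF that] by (simp add: heis_mult)
  have inv: "heis (- a) (a * cnj a - b) \<in> H" if "heis a b \<in> H" for a b
    using H.m_inv_closed[OF that] by (simp add: heis_inv)
  have one: "heis 0 0 \<in> H"
    using H.one_closed by (simp add: heis_one)
  have T1: "heis 1 (- \<omega>) \<in> H" and T2: "heis \<omega> (- \<omega>) \<in> H"
    by (auto simp: H_def T1_eq_heis T2_eq_heis intro: generate.incl)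
  \<comment> \<open>The image of \<open>H\<close> under the projection to the first
    coordinate.\<close>
  define P where "P = {a. \<exists>b. heis a b \<in> H}"
  have P_add: "x + y \<in> P" if "x \<in> P" "y \<in> P" for x y
    using that mult unfolding P_def by blast
  have P_uminus: "- x \<in> P" if "x \<in> P" for x
    using that inv unfolding P_def by blast
  have P_gens: "0 \<in> P" "1 \<in> P" "\<omega> \<in> P"
    using one T1 T2 unfolding P_def by blast+
  have P_multiple: "of_int k * x \<in> P" if "x \<in> P" for k x
    using that P_gens(1) P_add P_uminus by (rule of_int_mult_mem)
  \<comment> \<open>The kernel of that projection on \<open>H\<close>. The twist
    \<open>a * cnj c\<close> vanishes here, so multiplication is addition of second
    coordinates.\<close>
  define Z where "Z = {b. heis 0 b \<in> H}"
  have comm: "\<omega> - cnj \<omega> \<in> Z"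
    \<comment> \<open>The product \<open>T2 T1 T2^-1 T1^-1\<close>: its first coordinate cancels,
      and the twists leave \<open>\<omega> * cnj 1 - 1 * cnj \<omega>\<close>.\<close>
    using mult[OF mult[OF mult[OF T2 T1] inv[OF T2]] inv[OF T1]]
    by (simp add: Z_def algebra_simps)
  have Z_multiple: "of_int k * (\<omega> - cnj \<omega>) \<in> Z" for k
  proof (rule of_int_mult_mem[OF comm])
    show "0 \<in> Z" using one by (simp add: Z_def)
    show "x + y \<in> Z" if "x \<in> Z" "y \<in> Z" for x y
      using that mult[of 0 x 0 y] by (simp add: Z_def)
    show "- x \<in> Z" if "x \<in> Z" for x
      using that inv[of 0 x] by (simp add: Z_def)
  qed
  have "heis a b \<in> H" if N: "heis a b \<in> N_O_K" for a b
  proof -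
    from N obtain m n where a: "a = of_int m + of_int n * \<omega>"
      by (auto simp: heis_in_N_O_K O_K_def)
    have "of_int m * 1 + of_int n * \<omega> \<in> P"
      by (intro P_add P_multiple P_gens)
    then obtain b' where b': "heis a b' \<in> H"
      by (auto simp: P_def a)
    \<comment> \<open>Since \<open>b\<close> and \<open>b'\<close> satisfy the norm condition for
      the same \<open>a\<close>, their difference is purely imaginary.\<close>
    then have N': "heis a b' \<in> N_O_K"
      using gen_sub by (auto simp: H_def)
    have "b + - b' \<in> O_K"
      using N N' by (intro O_K_add O_K_uminus) (auto simp: heis_in_N_O_K)
    moreover have "b + cnj b = b' + cnj b'"
      using N N' by (simp add: heis_in_N_O_K)
    then have "(b + - b') + cnj (b + - b') = 0"
      by (simp add: algebra_simps)
    ultimately obtain k where "b + - b' = of_int k * (\<omega> - cnj \<omega>)"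
      by (rule O_K_imaginary)
    then have "heis 0 (b - b') \<in> H"
      using Z_multiple[of k] by (simp add: Z_def)
    then show ?thesis
      \<comment> \<open>Multiplying \<open>heis a b'\<close> on the right by the central element
        \<open>heis 0 (b - b')\<close> gives \<open>heis a b\<close>.\<close>
      using mult[OF b'] by fastforce
  qed
  then show "N_O_K \<subseteq> generate GL3 {T1, T2}"
    unfolding H_def by (auto simp: N_O_K_def)
qed

end
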